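(* Let $\mathcal{F}$, $\mathcal{A}$, $\lambda>0$, $\mathcal{G}=\mathcal{F}+\lambda\mathcal{A}$ and the FedAMP iteration be as in the context (no convexity is assumed). Assume that $\mathcal{F}$ and $\mathcal{A}$ are continuously differentiable on $\mathbb{R}^{d\times m}$ and that the gradients $\nabla\mathcal{F}$ and $\nabla\mathcal{A}$ are Lipschitz continuous with modulus $L$. Let $W^*$ be an optimal solution of $\min_W\mathcal{G}(W)$ and $\mathcal{G}^*=\mathcal{G}(W^* )$. (i) Let $B>0$. There is a constant $C\ge 0$, independent of $K$ (it may depend on the problem data $\mathcal{F},\mathcal{A},\lambda,L,B,W^0$), such that for every integer $K\ge 1$ the following holds. If $W^0,\dots,W^K$ is generated by FedAMP with step sizes $\alpha_1=\cdots=\alpha_K=\lambda/\sqrt{K}$, and if $\|\nabla\mathcal{F}(W^k)\|\le B$ and $\|\nabla\mathcal{A}(W^k)\|\le B/\lambda$ for every iterate $W^k$, then $$\min_{0\le k\le K}\|\nabla\mathcal{G}(W^k)\|^2\le\frac{18\left(\mathcal{G}(W^0)-\mathcal{G}^*+20LB^2\right)}{\sqrt{K}}+\frac{C}{K}.$$ (ii) Let $(W^k)_{k\ge0}$ be generated by FedAMP with step sizes $\alpha_k>0$ satisfying $\sum_{k=1}^\infty\alpha_k=\infty$ and $\sum_{k=1}^\infty\alpha_k^2<\infty$. Suppose that there is a constant $B>0$ such that $\|\nabla\mathcal{F}(W^k)\|\le B$ and $\|\nabla\mathcal{A}(W^k)\|\le B/\lambda$ for every $k\ge 0$. Then $$\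liminf_{k\to\infty}\|\nabla\mathcal{G}(W^k)\|=0.$$
   Context: Let $d,m\ge 1$ be integers and $\lambda>0$. For $i=1,\dots,m$ let $F_i:\mathbb{R}^d\to\mathbb{R}$ be a function (training loss of client $i$). For a matrix $W=[w_1,\dots,w_m]\in\mathbb{R}^{d\times m}$ with columns $w_i\in\mathbb{R}^d$, define $$\mathcal{F}(W)=\sum_{i=1}^m F_i(w_i),\qquad \mathcal{A}(W)=\sum_{1\le i<j\le m}A(\|w_i-w_j\|^2),\qquad \mathcal{G}(W)=\mathcal{F}(W)+\lambda\mathcal{A}(W).$$ Here $A:[0,\infty)\to\mathbb{R}$ is a non-linear function (an "attention-inducing" function) such that: $A$ is increasing and concave on $[0,\infty)$ with $A(0)=0$; $A$ is continuously differentiable on $(0,\infty)$; and $\lim_{t\to 0^+}A'(t)$ is finite. The norm $\|\cdot\|$ is the Euclidean norm on vectors and the Frobenius norm on matrices. The optimization problem is $\min_{W\in\mathbb{R}^{d\times m}}\mathcal{G}(W)$. FedAMP iteration: given an arbitrary $W^0\in\mathbb{R}^{d\times m}$ and step sizes $\alpha_k>0$, for $k=1,2,\dots$ set $$U^k=W^{k-1}-\alpha_k\nabla\mathcal{A}(W^{k-1}),\qquad W^k\in\arg\min_{W\in\mathbb{R}^{d\times m}}\ \mathcal{F}(W)+\frac{\lambda}{2\alpha_k}\|W-U^k\|^2 ,$$ i.e. $W^k$ is a (global) minimizer of the second problem; a sequence is said to be generated by FedAMP if it satisfies these relations. *)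

theory Defs
  imports "HOL-Analysis.Analysis"
begin

text \<open>
  A matrix $W = [w_1,\dots,w_m]$ with $m$ columns in $d$-dimensional space has type
  \<open>real ^ 'd ^ 'm\<close>, where \<open>W $ i\<close> is the column $w_i$. The library norm on this type is
  the Euclidean norm of the vector of column norms, i.e. the Frobenius norm. The column
  index type carries a linear order so that the sum over pairs $i < j$ can be written down;
  since types are nonempty, $d \ge 1$ and $m \ge 1$.
\<close>

type_synonym ('d, 'm) matrix = "((real, 'd) vec, 'm) vec"

definition gradient :: "('a::real_inner \<Rightarrow> real) \<Rightarrow> 'a \<Rightarrow> 'a" where
  "gradient f x = (THE D. GDERIV f x :> D)"

definition continuously_differentiable :: "('a::euclidean_space \<Rightarrow> real) \<Rightarrow> bool" where
  "continuously_differentiable f \<longleftrightarrow>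
     (\<forall>x. f differentiable (at x)) \<and> continuous_on UNIV (gradient f)"

text \<open>
  Only the values on $[0,\infty)$ matter. ``Increasing'' is read in the weak sense, and
  ``non-linear'' means not of the form $t \mapsto c t$ on $[0,\infty)$.
\<close>

definition attention_inducing :: "(real \<Rightarrow> real) \<Rightarrow> bool" where
  "attention_inducing A \<longleftrightarrow>
     \<not> (\<exists>c. \<forall>t\<ge>0. A t = c * t) \<and>
     mono_on {0..} A \<and> concave_on {0..} A \<and> A 0 = 0 \<and>
     A differentiable_on {0<..} \<and> continuous_on {0<..} (deriv A) \<and>
     (\<exists>l. (deriv A \<longlongrightarrow> l) (at_right 0))"

definition total_loss :: "('m::finite \<Rightarrow> real ^ 'd \<Rightarrow> real) \<Rightarrow> ('d, 'm) matrix \<Rightarrow> real" where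
  "total_loss F W = (\<Sum>i\<in>UNIV. F i (W $ i))"

definition attention :: "(real \<Rightarrow> real) \<Rightarrow> ('d::finite, 'm::{finite, linorder}) matrix \<Rightarrow> real" where
  "attention A W = (\<Sum>(i, j) | i < j. A ((norm (W $ i - W $ j))\<^sup>2))"

definition objective ::
  "('m::{finite, linorder} \<Rightarrow> real ^ 'd \<Rightarrow> real) \<Rightarrow> (real \<Rightarrow> real) \<Rightarrow> real
     \<Rightarrow> ('d, 'm) matrix \<Rightarrow> real" where
  "objective F A lam W = total_loss F W + lam * attention A W"

definition global_minimizer :: "('a \<Rightarrow> real) \<Rightarrow> 'a \<Rightarrow> bool" where
  "global_minimizer f x \<longleftrightarrow> is_arg_min f (\<lambda>_. True) x"

text \<open>
  \<open>fedamp_step F A lam a V W\<close> says that $W$ is a possible successor of the iterate $V$ with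
  step size $a$; it is a relation because the proximal subproblem need not have a unique
  minimizer (or any at all).
\<close>

definition fedamp_step ::
  "('m::{finite, linorder} \<Rightarrow> real ^ 'd \<Rightarrow> real) \<Rightarrow> (real \<Rightarrow> real) \<Rightarrow> real \<Rightarrow> real
     \<Rightarrow> ('d, 'm) matrix \<Rightarrow> ('d, 'm) matrix \<Rightarrow> bool" where
  "fedamp_step F A lam a V W \<longleftrightarrow>
     (let U = V - a *\<^sub>R gradient (attention A) V
      in global_minimizer (\<lambda>X. total_loss F X + lam / (2 * a) * (norm (X - U))\<^sup>2) W)"

end

theory Submission imports Defs begin

text \<open>
  Write $f$ for the total loss and $h$ for the attention term. Comparing a proximal minimizer
  $W$ with the previous iterate $V$, and bounding $h$ by its quadratic upper model at $V$, gives
  $G(W) \le G(V) - \frac{\lambda}{2}(\frac{1}{\alpha} - L)\|W - V\|^2$. The optimality condition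
  of the subproblem gives $\nabla G(W) = -\frac{\lambda}{\alpha}(W - V)
  + \lambda(\nabla h(W) - \nabla h(V))$. Hence, as soon as $\alpha L \le 1/2$,
  $\alpha\|\nabla G(W)\|^2 \le 9\lambda(G(V) - G(W))$, and both parts follow by telescoping.
  In part (i) the step size $\lambda/\sqrt K$ violates $\alpha L \le 1/2$ for the finitely many
  $K < 4\lambda^2L^2$; there $\|\nabla G\| \le 2B$, which the term $C/K$ absorbs.
\<close>

section \<open>Gradients as unique Riesz representatives\<close>

text \<open>Since \<open>gradient\<close> is a definite description, both existence and uniqueness
  are required. Existence is the Riesz representation in coordinates: \<open>D\<close> collects the
  partial derivatives. Uniqueness follows from that of the derivative, because inner products
  determine a vector.\<close>

lemma GDERIV_gradient:
  fixes f :: "'a::euclidean_space \<Rightarrow> real"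
  assumes "f differentiable (at x)"
  shows "GDERIV f x :> gradient f x"
proof -
  obtain f' where f': "(f has_derivative f') (at x)"
    using assms by (auto simp: differentiable_def)
  interpret f': bounded_linear f'
    using f' by (rule has_derivative_bounded_linear)
  define D where "D = (\<Sum>b\<in>Basis. f' b *\<^sub>R b)"
  have "f' v = v \<bullet> D" for v
  proof -
    have "f' v = f' (\<Sum>b\<in>Basis. (v \<bullet> b) *\<^sub>R b)"
      by (simp add: euclidean_representation)
    also have "\<dots> = (\<Sum>b\<in>Basis. (v \<bullet> b) * f' b)"
      by (simp add: f'.sum f'.scaleR)
    also have "\<dots> = v \<bullet> D"
      by (simp add: D_def inner_sum_right mult.commute)
    finally show ?thesis .
  qed
  then have "f' = (\<lambda>v. v \<bullet> D)" by (rule ext)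
  with f' have D: "GDERIV f x :> D" by (simp add: gderiv_def)
  have "E = D" if "GDERIV f x :> E" for E
  proof -
    have "(\<lambda>v. v \<bullet> E) = (\<lambda>v. v \<bullet> D)"
      using that D unfolding gderiv_def by (rule has_derivative_unique)
    then show ?thesis by (metis vector_eq_ldot)
  qed
  with D show ?thesis unfolding gradient_def by (rule theI)
qed

lemma gradient_eqI:
  fixes f :: "'a::euclidean_space \<Rightarrow> real"
  assumes "GDERIV f x :> D"
  shows "gradient f x = D"
proof -
  have "f differentiable (at x)"
    using assms by (auto simp: gderiv_def differentiable_def)
  then have "GDERIV f x :> gradient f x" by (rule GDERIV_gradient)
  then have "(\<lambda>v. v \<bullet> gradient f x) = (\<lambda>v. v \<bullet> D)"
    using assms unfolding gderiv_def by (rule has_derivative_unique)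
  then show ?thesis by (metis vector_eq_ldot)
qed

section \<open>Energy decrease of one proximal step\<close>

text \<open>Along the segment from \<open>v\<close> to \<open>w\<close>, the slope of
  \<open>h\<close> exceeds its initial value by at most \<open>L * t * (norm d)\<^sup>2\<close>. So
  \<open>h\<close> minus its quadratic model, which is \<open>p\<close>, is nonincreasing on the
  unit interval.\<close>

lemma lipschitz_gradient_upper_bound:
  fixes h :: "'a::real_inner \<Rightarrow> real"
  assumes h: "\<And>x. GDERIV h x :> g x" and lip: "L-lipschitz_on UNIV g"
  shows "h w \<le> h v + g v \<bullet> (w - v) + L / 2 * (norm (w - v))\<^sup>2"
proof -
  define d where "d = w - v"
  define p where "p t = h (v + t *\<^sub>R d) - t * (g v \<bullet> d) - L / 2 * t\<^sup>2 * (norm d)\<^sup>2" for t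
  have "p 1 \<le> p 0"
  proof (rule DERIV_nonpos_imp_nonincreasing[where f = p])
    fix t :: real assume t: "0 \<le> t" "t \<le> 1"
    have line: "((\<lambda>t. v + t *\<^sub>R d) has_derivative (\<lambda>s. s *\<^sub>R d)) (at t)"
      by (auto intro!: derivative_eq_intros)
    have "(h has_derivative (\<lambda>u. u \<bullet> g (v + t *\<^sub>R d))) (at (v + t *\<^sub>R d))"
      using h by (simp add: gderiv_def)
    from has_derivative_compose[OF line this]
    have "((\<lambda>t. h (v + t *\<^sub>R d)) has_real_derivative (d \<bullet> g (v + t *\<^sub>R d))) (at t)"
      by (simp add: has_field_derivative_def mult_commute_abs)
    then have "(p has_real_derivative
        (d \<bullet> g (v + t *\<^sub>R d) - g v \<bullet> d - L * t * (norm d)\<^sup>2)) (at t)"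
      unfolding p_def by (auto intro!: derivative_eq_intros)
    moreover have "d \<bullet> g (v + t *\<^sub>R d) - g v \<bullet> d - L * t * (norm d)\<^sup>2 \<le> 0"
    proof -
      have "d \<bullet> g (v + t *\<^sub>R d) - g v \<bullet> d = d \<bullet> (g (v + t *\<^sub>R d) - g v)"
        by (simp add: inner_diff_right inner_commute)
      also have "\<dots> \<le> norm d * norm (g (v + t *\<^sub>R d) - g v)"
        by (rule norm_cauchy_schwarz)
      also have "\<dots> \<le> norm d * (L * norm (t *\<^sub>R d))"
        using lipschitz_onD[OF lip, of "v + t *\<^sub>R d" v]
        by (intro mult_left_mono) (auto simp: dist_norm)
      also have "\<dots> = L * t * (norm d)\<^sup>2"
        using t by (simp add: power2_eq_square)
      finally show ?thesis by simp
    qed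
    ultimately show "\<exists>y. (p has_real_derivative y) (at t) \<and> y \<le> 0" by blast
  qed simp
  then show ?thesis by (simp add: p_def d_def)
qed

text \<open>Fermat's rule: the derivative of the proximal objective vanishes at a global minimizer.
  The squared norm becomes an inner product so that it can be differentiated everywhere.\<close>

lemma prox_optimality:
  fixes f :: "'a::real_inner \<Rightarrow> real"
  assumes f: "GDERIV f w :> g"
    and min: "global_minimizer (\<lambda>x. f x + c / 2 * (norm (x - u))\<^sup>2) w"
  shows "g = - c *\<^sub>R (w - u)"
proof -
  have "((\<lambda>x. f x + c / 2 * ((x - u) \<bullet> (x - u))) has_derivative
      (\<lambda>v. v \<bullet> (g + c *\<^sub>R (w - u)))) (at w)"
    using f unfolding gderiv_def
    by (auto intro!: derivative_eq_intros simp: inner_add_right inner_commute)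
  then have "(\<lambda>v. v \<bullet> (g + c *\<^sub>R (w - u))) = (\<lambda>v. 0)"
    using min by (intro has_derivative_local_min)
      (auto simp: global_minimizer_def is_arg_min_linorder power2_norm_eq_inner)
  then have "g + c *\<^sub>R (w - u) = 0" by (metis inner_eq_zero_iff)
  then show ?thesis by (metis add_eq_0_iff2 scaleR_minus_left)
qed

text \<open>The step length \<open>norm d\<close> links two estimates: the energy drop is at least
  \<open>lam / (4 * a) * (norm d)\<^sup>2\<close>, and the new gradient has norm at most
  \<open>3 / 2 * (lam / a) * norm d\<close>. Eliminating it gives the constant 9, which is 4 times
  the square of 3/2.\<close>

lemma prox_step_descent:
  fixes f h :: "'a::real_inner \<Rightarrow> real"
  assumes "lam > 0" "a > 0" and aL: "a * L \<le> 1 / 2"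
    and f: "\<And>x. GDERIV f x :> gf x" and h: "\<And>x. GDERIV h x :> gh x"
    and lip: "L-lipschitz_on UNIV gh"
    and min: "global_minimizer (\<lambda>x. f x + lam / (2 * a) * (norm (x - (v - a *\<^sub>R gh v)))\<^sup>2) w"
  shows "a * (norm (gf w + lam *\<^sub>R gh w))\<^sup>2 \<le> 9 * lam * ((f v + lam * h v) - (f w + lam * h w))"
proof -
  define d where "d = w - v"
  have wu: "w - (v - a *\<^sub>R gh v) = d + a *\<^sub>R gh v" by (simp add: d_def)
  \<comment> \<open>The minimizer is tested against the previous iterate \<open>v\<close>, whose
    offset from the proximal center is \<open>a *\<^sub>R gh v\<close>.\<close>
  have "f w + lam / (2 * a) * (norm (d + a *\<^sub>R gh v))\<^sup>2 \<le> f v + lam / (2 * a) * (norm (a *\<^sub>R gh v))\<^sup>2"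
    using min[unfolded global_minimizer_def is_arg_min_linorder, THEN conjunct2, rule_format, of v] wu
    by simp
  moreover have "(norm (d + a *\<^sub>R gh v))\<^sup>2
      = (norm d)\<^sup>2 + 2 * a * (gh v \<bullet> d) + (norm (a *\<^sub>R gh v))\<^sup>2"
    unfolding power2_norm_eq_inner
    by (simp add: inner_add_left inner_add_right inner_commute)
  \<comment> \<open>The cross term is exactly the linear term in the quadratic model of
    \<open>lam * h\<close>, so it cancels when the two estimates are added.\<close>
  moreover have "lam / (2 * a) * (2 * a * (gh v \<bullet> d)) = lam * (gh v \<bullet> d)"
    using \<open>a > 0\<close> by simp
  ultimately have "f w \<le> f v - lam / (2 * a) * (norm d)\<^sup>2 - lam * (gh v \<bullet> d)"
    by (simp only: distrib_left)
  moreover have "lam * h w \<le> lam * (h v + gh v \<bullet> d + L / 2 * (norm d)\<^sup>2)"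
    using lipschitz_gradient_upper_bound[OF h lip, of w v] \<open>lam > 0\<close>
    by (simp add: d_def)
  moreover have "lam / (2 * a) * (1 - a * L) * (norm d)\<^sup>2
      = lam / (2 * a) * (norm d)\<^sup>2 - lam * (L / 2 * (norm d)\<^sup>2)"
    using \<open>a > 0\<close> by (simp add: field_simps)
  ultimately have "lam / (2 * a) * (1 - a * L) * (norm d)\<^sup>2
      \<le> (f v + lam * h v) - (f w + lam * h w)"
    unfolding distrib_left by linarith
  \<comment> \<open>The bound on \<open>a * L\<close> keeps at least half of the quadratic
    gain.\<close>
  moreover have "lam / (2 * a) * (1 / 2) * (norm d)\<^sup>2 \<le> lam / (2 * a) * (1 - a * L) * (norm d)\<^sup>2"
    using aL \<open>a > 0\<close> \<open>lam > 0\<close> by (intro mult_right_mono mult_left_mono) auto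
  ultimately have desc: "lam / (4 * a) * (norm d)\<^sup>2 \<le> (f v + lam * h v) - (f w + lam * h w)"
    by simp
  have "gf w = - (lam / a) *\<^sub>R (d + a *\<^sub>R gh v)"
    using prox_optimality[OF f, where c = "lam / a"] min wu by (simp add: mult.commute)
  \<comment> \<open>The explicit gradient at \<open>v\<close> hidden in the center pairs with the
    one at \<open>w\<close>; their difference is of order \<open>norm d\<close> by Lipschitz
    continuity.\<close>
  then have "gf w + lam *\<^sub>R gh w = - (lam / a) *\<^sub>R d + lam *\<^sub>R (gh w - gh v)"
    using \<open>a > 0\<close> by (simp add: scaleR_add_right scaleR_diff_right)
  also have "norm \<dots> \<le> lam / a * norm d + lam * norm (gh w - gh v)"
    using \<open>a > 0\<close> \<open>lam > 0\<close> by (intro norm_triangle_le) simp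
  also have "\<dots> \<le> lam / a * norm d + lam * (L * norm d)"
    using lipschitz_onD[OF lip, of w v] \<open>lam > 0\<close> by (simp add: dist_norm d_def)
  also have "\<dots> = lam / a * norm d * (1 + a * L)"
    using \<open>a > 0\<close> by (simp add: field_simps)
  also have "\<dots> \<le> lam / a * norm d * (3 / 2)"
    using aL \<open>a > 0\<close> \<open>lam > 0\<close> by (intro mult_left_mono) auto
  finally have "(norm (gf w + lam *\<^sub>R gh w))\<^sup>2 \<le> (lam / a * norm d * (3 / 2))\<^sup>2"
    by (rule power_mono) simp
  then have "a * (norm (gf w + lam *\<^sub>R gh w))\<^sup>2 \<le> a * (lam / a * norm d * (3 / 2))\<^sup>2"
    using \<open>a > 0\<close> by simp
  also have "\<dots> = 9 * lam * (lam / (4 * a) * (norm d)\<^sup>2)"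
    using \<open>a > 0\<close> by (simp add: field_simps power2_eq_square)
  also have "\<dots> \<le> 9 * lam * ((f v + lam * h v) - (f w + lam * h w))"
    using desc \<open>lam > 0\<close> by (intro mult_left_mono) auto
  finally show ?thesis .
qed

lemma gradient_objective:
  assumes "continuously_differentiable (total_loss F)"
    and "continuously_differentiable (attention A :: ('d::finite, 'm::{finite, linorder}) matrix \<Rightarrow> real)"
  shows "gradient (objective F A lam) (W :: ('d, 'm) matrix)
    = gradient (total_loss F) W + lam *\<^sub>R gradient (attention A) W"
proof (rule gradient_eqI)
  have "GDERIV (total_loss F) W :> gradient (total_loss F) W"
    "GDERIV (attention A) W :> gradient (attention A) W"
    using assms by (auto simp: continuously_differentiable_def intro: GDERIV_gradient)
  then show "GDERIV (objective F A lam) W :> gradient (total_loss F) W + lam *\<^sub>R gradient (attention A) W"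
    unfolding gderiv_def objective_def [abs_def]
    by (auto intro!: derivative_eq_intros simp: inner_add_right)
qed

lemma fedamp_step_descent:
  fixes V W :: "('d::finite, 'm::{finite, linorder}) matrix"
  assumes "lam > 0" "a > 0" "a * L \<le> 1 / 2"
    and f: "continuously_differentiable (total_loss F)"
    and h: "continuously_differentiable (attention A :: ('d, 'm) matrix \<Rightarrow> real)"
    and "L-lipschitz_on UNIV (gradient (attention A :: ('d, 'm) matrix \<Rightarrow> real))"
    and "fedamp_step F A lam a V W"
  shows "a * (norm (gradient (objective F A lam) W))\<^sup>2
    \<le> 9 * lam * (objective F A lam V - objective F A lam W)"
  unfolding gradient_objective[OF f h] objective_def
  using assms
  by (intro prox_step_descent)
    (auto simp: continuously_differentiable_def fedamp_step_def Let_def intro: GDERIV_gradient)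

section \<open>Summation of the descent inequality\<close>

text \<open>The free starting index \<open>N\<close> serves both uses: 0 for the fixed step size,
  and a threshold when descent holds only eventually. The left-open range makes \<open>k - 1\<close>
  a true predecessor.\<close>

lemma telescoped_descent:
  fixes a x G :: "nat \<Rightarrow> real"
  assumes "\<And>k. k \<in> {N<..n} \<Longrightarrow> a k * x k \<le> c * (G (k - 1) - G k)" and "N \<le> n"
  shows "(\<Sum>k\<in>{N<..n}. a k * x k) \<le> c * (G N - G n)"
proof -
  have "(\<Sum>k\<in>{N<..n}. a k * x k) \<le> (\<Sum>k\<in>{N<..n}. c * (G (k - 1) - G k))"
    using assms(1) by (rule sum_mono)
  also have "\<dots> = c * (G N - G n)"
    using \<open>N \<le> n\<close>
  proof (induction rule: dec_induct)
    case (step n)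
    then have "{N<..Suc n} = insert (Suc n) {N<..n}" by auto
    with step.IH show ?case by (simp add: algebra_simps)
  qed simp
  finally show ?thesis .
qed

text \<open>If \<open>x\<close> eventually stayed above some \<open>e > 0\<close>, each late step
  would cost at least \<open>a k * e\<^sup>2\<close> of an energy bounded below, so the step sizes
  would have bounded partial sums.\<close>

lemma liminf_zero_of_descent:
  fixes a x G :: "nat \<Rightarrow> real"
  assumes "c \<ge> 0" and x0: "\<And>k. x k \<ge> 0" and G: "\<And>k. G k \<ge> Gmin" and a: "\<And>k. k \<ge> 1 \<Longrightarrow> a k > 0"
    and div: "filterlim (\<lambda>n. \<Sum>k=1..n. a k) at_top sequentially"
    and ev: "\<forall>\<^sub>F k in sequentially. a k * (x k)\<^sup>2 \<le> c * (G (k - 1) - G k)"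
  shows "liminf (\<lambda>k. ereal (x k)) = 0"
proof (rule antisym)
  show "0 \<le> liminf (\<lambda>k. ereal (x k))"
    using x0 by (intro Liminf_bounded) auto
  show "liminf (\<lambda>k. ereal (x k)) \<le> 0"
  proof (rule ccontr)
    assume "\<not> ?thesis"
    \<comment> \<open>The liminf may be infinite, so a real number strictly between it and 0 is
      chosen.\<close>
    then obtain e where e: "0 < ereal e" "ereal e < liminf (\<lambda>k. ereal (x k))"
      using ereal_dense2[of 0 "liminf (\<lambda>k. ereal (x k))"] by (auto simp: not_le)
    then have "\<forall>\<^sub>F k in sequentially. e < x k"
      by (auto dest: less_LiminfD)
    then have "\<forall>\<^sub>F k in sequentially. e < x k \<and> a k * (x k)\<^sup>2 \<le> c * (G (k - 1) - G k)"
      using ev by (rule eventually_conj)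
    then obtain N where N: "\<And>k. k \<ge> N \<Longrightarrow> e < x k \<and> a k * (x k)\<^sup>2 \<le> c * (G (k - 1) - G k)"
      unfolding eventually_sequentially by auto
    \<comment> \<open>The first \<open>N\<close> steps are counted as they are; the remaining ones
      are paid from the energy available after index \<open>N\<close>.\<close>
    define M where "M = (\<Sum>k=1..N. a k) + c * (G N - Gmin) / e\<^sup>2"
    have bound: "(\<Sum>k=1..n. a k) \<le> M" if "n \<ge> N" for n
    proof -
      have "e\<^sup>2 * (\<Sum>k\<in>{N<..n}. a k) = (\<Sum>k\<in>{N<..n}. a k * e\<^sup>2)"
        by (simp add: mult.commute[of "e\<^sup>2"] sum_distrib_right)
      also have "\<dots> \<le> (\<Sum>k\<in>{N<..n}. a k * (x k)\<^sup>2)"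
        using N a e by (intro sum_mono mult_left_mono power_mono) (auto simp: less_imp_le)
      also have "\<dots> \<le> c * (G N - G n)"
        using N that by (intro telescoped_descent) auto
      also have "\<dots> \<le> c * (G N - Gmin)"
        using G \<open>c \<ge> 0\<close> by (intro mult_left_mono) auto
      finally have "(\<Sum>k\<in>{N<..n}. a k) \<le> c * (G N - Gmin) / e\<^sup>2"
        using e by (simp add: field_simps)
      moreover have "(\<Sum>k=1..n. a k) = (\<Sum>k=1..N. a k) + (\<Sum>k\<in>{N<..n}. a k)"
      proof -
        have "{1..n} = {1..N} \<union> {N<..n}" using that by auto
        also have "sum a ({1..N} \<union> {N<..n}) = sum a {1..N} + sum a {N<..n}"
          by (rule sum.union_disjoint) auto
        finally show ?thesis .
      qed
      ultimately show ?thesis by (simp add: M_def)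
    qed
    have "\<forall>\<^sub>F n in sequentially. M < (\<Sum>k=1..n. a k)"
      using div by (simp add: filterlim_at_top_dense)
    then have "\<forall>\<^sub>F n in sequentially. n \<ge> N \<and> M < (\<Sum>k=1..n. a k)"
      using eventually_ge_at_top by (intro eventually_conj) auto
    then obtain n where "n \<ge> N" "M < (\<Sum>k=1..n. a k)"
      unfolding eventually_sequentially by auto
    with bound show False by fastforce
  qed
qed

section \<open>Rate for fixed steps and convergence for diminishing steps\<close>

theorem theorem2:
  fixes F :: "'m::{finite, linorder} \<Rightarrow> real ^ 'd \<Rightarrow> real"
    and A :: "real \<Rightarrow> real"
    and lam L :: real
    and Wstar :: "('d, 'm) matrix"
  assumes "lam > 0"
    and "attention_inducing A"
    and "continuously_differentiable (total_loss F)"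
    and "continuously_differentiable (attention A :: ('d, 'm) matrix \<Rightarrow> real)"
    and "L-lipschitz_on UNIV (gradient (total_loss F))"
    and "L-lipschitz_on UNIV (gradient (attention A :: ('d, 'm) matrix \<Rightarrow> real))"
    and "global_minimizer (objective F A lam) Wstar"
  shows
    "(\<forall>B>0. \<forall>W0 :: ('d, 'm) matrix. \<exists>C\<ge>0. \<forall>K::nat. K \<ge> 1 \<longrightarrow>
        (\<forall>W :: nat \<Rightarrow> ('d, 'm) matrix.
           W 0 = W0 \<and>
           (\<forall>k\<in>{1..K}. fedamp_step F A lam (lam / sqrt (real K)) (W (k - 1)) (W k)) \<and>
           (\<forall>k\<le>K. norm (gradient (total_loss F) (W k)) \<le> B \<and>
                   norm (gradient (attention A) (W k)) \<le> B / lam) \<longrightarrow>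
           (MIN k\<in>{0..K}. (norm (gradient (objective F A lam) (W k)))\<^sup>2)
             \<le> 18 * (objective F A lam W0 - objective F A lam Wstar + 20 * L * B\<^sup>2) / sqrt (real K)
                + C / real K))
     \<and>
     (\<forall>(alpha :: nat \<Rightarrow> real) (W :: nat \<Rightarrow> ('d, 'm) matrix).
        (\<forall>k\<ge>1. alpha k > 0) \<and>
        filterlim (\<lambda>n. \<Sum>k=1..n. alpha k) at_top sequentially \<and>
        summable (\<lambda>k. (alpha (Suc k))\<^sup>2) \<and>
        (\<forall>k\<ge>1. fedamp_step F A lam (alpha k) (W (k - 1)) (W k)) \<and>
        (\<exists>B>0. \<forall>k. norm (gradient (total_loss F) (W k)) \<le> B \<and>
                    norm (gradient (attention A) (W k)) \<le> B / lam) \<longrightarrow>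
        liminf (\<lambda>k. ereal (norm (gradient (objective F A lam) (W k)))) = 0)"
proof (intro conjI allI impI)
  define G where "G = objective F A lam"
  note descent = fedamp_step_descent[OF assms(1) _ _ assms(3,4,6), folded G_def]
  have G: "G Wstar \<le> G W" for W
    using assms(7) by (simp add: G_def global_minimizer_def is_arg_min_linorder)
  have "L \<ge> 0" using assms(5) by (rule lipschitz_on_nonneg)
  show "\<exists>C\<ge>0. \<forall>K::nat. K \<ge> 1 \<longrightarrow>
        (\<forall>W :: nat \<Rightarrow> ('d, 'm) matrix.
           W 0 = W0 \<and>
           (\<forall>k\<in>{1..K}. fedamp_step F A lam (lam / sqrt (real K)) (W (k - 1)) (W k)) \<and>
           (\<forall>k\<le>K. norm (gradient (total_loss F) (W k)) \<le> B \<and>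
                   norm (gradient (attention A) (W k)) \<le> B / lam) \<longrightarrow>
           (MIN k\<in>{0..K}. (norm (gradient (objective F A lam) (W k)))\<^sup>2)
             \<le> 18 * (objective F A lam W0 - objective F A lam Wstar + 20 * L * B\<^sup>2) / sqrt (real K)
                + C / real K)" if "B > 0" for B and W0 :: "('d, 'm) matrix"
    unfolding G_def[symmetric]
  \<comment> \<open>The witness comes from the large-step case below: there the minimum is at most
    \<open>4 * B\<^sup>2\<close>, and \<open>2 * (lam / sqrt K * L)\<close> exceeds 1, so its square
    may be inserted as a factor.\<close>
  proof (intro exI[of _ "16 * B\<^sup>2 * lam\<^sup>2 * L\<^sup>2"] conjI allI impI)
    fix K :: nat and W :: "nat \<Rightarrow> ('d, 'm) matrix"
    assume "K \<ge> 1" and W: "W 0 = W0 \<and>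
      (\<forall>k\<in>{1..K}. fedamp_step F A lam (lam / sqrt (real K)) (W (k - 1)) (W k)) \<and>
      (\<forall>k\<le>K. norm (gradient (total_loss F) (W k)) \<le> B \<and>
              norm (gradient (attention A) (W k)) \<le> B / lam)"
    define M where "M = (MIN k\<in>{0..K}. (norm (gradient G (W k)))\<^sup>2)"
    have M: "M \<le> (norm (gradient G (W k)))\<^sup>2" if "k \<le> K" for k
      unfolding M_def using that by (intro Min_le) auto
    define s where "s = sqrt (real K)"
    have s: "s > 0" "s\<^sup>2 = real K" using \<open>K \<ge> 1\<close> by (auto simp: s_def)
    have "M \<le> 18 * (G W0 - G Wstar + 20 * L * B\<^sup>2) / s + 16 * B\<^sup>2 * lam\<^sup>2 * L\<^sup>2 / real K"
    proof (cases "lam / s * L \<le> 1 / 2")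
      case True
      have "lam / s * (norm (gradient G (W k)))\<^sup>2 \<le> 9 * lam * (G (W (k - 1)) - G (W k))"
        if "k \<in> {0<..K}" for k
        using W that True s \<open>lam > 0\<close> by (intro descent) (auto simp: s_def)
      then have "(\<Sum>k\<in>{0<..K}. lam / s * (norm (gradient G (W k)))\<^sup>2) \<le> 9 * lam * (G (W 0) - G (W K))"
        by (intro telescoped_descent) auto
      moreover have "(\<Sum>k\<in>{0<..K}. lam / s * M) \<le> (\<Sum>k\<in>{0<..K}. lam / s * (norm (gradient G (W k)))\<^sup>2)"
        using M s \<open>lam > 0\<close> by (intro sum_mono mult_left_mono) auto
      \<comment> \<open>There are \<open>K\<close> equal summands and \<open>K\<close> is the square
        of \<open>s\<close>; this yields the rate of order \<open>1 / s\<close>.\<close>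
      moreover have "(\<Sum>k\<in>{0<..K}. lam / s * M) = lam * s * M"
        using s by (simp add: s(2)[symmetric] power2_eq_square)
      moreover have "9 * lam * (G (W 0) - G (W K)) \<le> 9 * lam * (G W0 - G Wstar)"
        using W G[of "W K"] \<open>lam > 0\<close> by (intro mult_left_mono) auto
      ultimately have "lam * (s * M) \<le> lam * (9 * (G W0 - G Wstar))"
        by (simp add: mult_ac)
      then have "s * M \<le> 9 * (G W0 - G Wstar)"
        using \<open>lam > 0\<close> by simp
      \<comment> \<open>The estimate with 9 is relaxed to the stated bound, as the optimality gap
        and \<open>L\<close> are nonnegative.\<close>
      also have "\<dots> \<le> 18 * (G W0 - G Wstar + 20 * L * B\<^sup>2)"
      proof -
        have "9 * (G W0 - G Wstar) \<le> 18 * (G W0 - G Wstar)" using G[of W0] by simp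
        also have "\<dots> \<le> 18 * (G W0 - G Wstar + 20 * L * B\<^sup>2)" using \<open>L \<ge> 0\<close> by simp
        finally show ?thesis .
      qed
      finally have "M \<le> 18 * (G W0 - G Wstar + 20 * L * B\<^sup>2) / s"
        using s by (simp add: pos_le_divide_eq mult.commute)
      then show ?thesis by (simp add: add_increasing2)
    next
      case False
      \<comment> \<open>The initial iterate alone suffices here: the minimum includes index 0, and
        its gradient is bounded by assumption.\<close>
      have "norm (gradient G (W 0)) \<le> norm (gradient (total_loss F) (W 0))
          + lam * norm (gradient (attention A) (W 0))"
        unfolding G_def gradient_objective[OF assms(3,4)]
        using \<open>lam > 0\<close> by (intro norm_triangle_le) simp
      also have "\<dots> \<le> B + lam * (B / lam)"
        using W \<open>lam > 0\<close> by (intro add_mono mult_left_mono) auto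
      finally have "norm (gradient G (W 0)) \<le> 2 * B" using \<open>lam > 0\<close> by simp
      then have "(norm (gradient G (W 0)))\<^sup>2 \<le> (2 * B)\<^sup>2" by (rule power_mono) simp
      with M[of 0] have "M \<le> 4 * B\<^sup>2 * 1" by (simp add: power_mult_distrib)
      also have "1 \<le> (2 * (lam / s * L))\<^sup>2"
        using False by (intro one_le_power) linarith
      then have "4 * B\<^sup>2 * 1 \<le> 4 * B\<^sup>2 * (2 * (lam / s * L))\<^sup>2"
        by (intro mult_left_mono) auto
      also have "\<dots> = 16 * B\<^sup>2 * lam\<^sup>2 * L\<^sup>2 / real K"
        by (simp add: power_mult_distrib power_divide s)
      finally show ?thesis
        using G[of W0] \<open>L \<ge> 0\<close> s by (intro add_increasing) auto
    qed
    then show "(MIN k\<in>{0..K}. (norm (gradient G (W k)))\<^sup>2)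
      \<le> 18 * (G W0 - G Wstar + 20 * L * B\<^sup>2) / sqrt (real K) + 16 * B\<^sup>2 * lam\<^sup>2 * L\<^sup>2 / real K"
      by (simp add: M_def s_def)
  qed simp
  show "liminf (\<lambda>k. ereal (norm (gradient (objective F A lam) (W k)))) = 0"
    if H: "(\<forall>k\<ge>1. alpha k > 0) \<and>
        filterlim (\<lambda>n. \<Sum>k=1..n. alpha k) at_top sequentially \<and>
        summable (\<lambda>k. (alpha (Suc k))\<^sup>2) \<and>
        (\<forall>k\<ge>1. fedamp_step F A lam (alpha k) (W (k - 1)) (W k)) \<and>
        (\<exists>B>0. \<forall>k. norm (gradient (total_loss F) (W k)) \<le> B \<and>
                    norm (gradient (attention A) (W k)) \<le> B / lam)"
    for alpha :: "nat \<Rightarrow> real" and W :: "nat \<Rightarrow> ('d, 'm) matrix"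
    unfolding G_def[symmetric]
  proof (rule liminf_zero_of_descent[where a = alpha and G = "\<lambda>k. G (W k)" and Gmin = "G Wstar"])
    \<comment> \<open>Square summability drives the step sizes to 0, so the smallness condition on
      \<open>alpha k * L\<close> holds from some index on.\<close>
    have "(\<lambda>k. (alpha (Suc k))\<^sup>2) \<longlonglongrightarrow> 0"
      using H by (intro summable_LIMSEQ_zero) auto
    then have "(\<lambda>k. alpha (Suc k)) \<longlonglongrightarrow> 0"
      by simp
    then have "alpha \<longlonglongrightarrow> 0" by (rule LIMSEQ_imp_Suc)
    then have "(\<lambda>k. alpha k * L) \<longlonglongrightarrow> 0" by (rule tendsto_mult_left_zero)
    then have "\<forall>\<^sub>F k in sequentially. alpha k * L < 1 / 2"
      by (rule order_tendstoD) simp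
    then show "\<forall>\<^sub>F k in sequentially. alpha k * (norm (gradient G (W k)))\<^sup>2
        \<le> 9 * lam * (G (W (k - 1)) - G (W k))"
      using eventually_ge_at_top[of 1]
    proof eventually_elim
      case (elim k)
      with H show ?case by (intro descent) auto
    qed
  qed (use H G \<open>lam > 0\<close> in auto)
qed

end
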